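(* For every $\lambda\in\mathbb Q_{>1}$, the group $G_\lambda$ is fully left-orderable. Every partial left-order on $G_\lambda$ can be extended to a left-order of type (1) or (2), and so every left-order on $G_\lambda$ is of type (1) or (2).
   Context: A partial left-order on a group $G$ is a partial order $\le$ on $G$ such that $a\le b$ implies $ca\le cb$ for all $a,b,c\in G$; it is a left-order if it is total. It is identified with its positive cone $\{a\in G\mid e<a\}$, and one order extends another if its positive cone contains that of the other. $G$ is fully left-orderable if every partial left-order on $G$ extends to a left-order on $G$. For $\lambda\in\mathbb Q_{>1}$, $G_\lambda$ is the group (under composition) of maps $\mathbb Q\to\mathbb Q$ $$G_\lambda=\{x\mapsto\lambda^nx+c\mid n\in\mathbb Z,\ c\in\mathbb Z[\lambda,\lambda^{-1}]\},$$ with identity $e\colon x\mapsto x$; its elements are also regarded as affine maps of $\mathbb R$. Let $\pi\colon G_\lambda\to\mathbb Z$ send $x\mapsto\lambda^nx+c$ to $n$. The following left-orders $\succ$ on $G_\lambda$, given by their positive cones, are considered. Type (1): for $(\sigma_1,\sigma_2)\in\{+,-\}^2$, $f\succ e$ if and only if $\sigma_1\cdot\pi(f)>0$, or ($\pi(f)=0$ and $\sigma_2\cdot f(0)>0$). Type (2): for $p\in\mathbb R$ and $(\sigma_1,\sigma_2)\in\{+,-\}^2$, $f\succ e$ if and only if $\sigma_1\cdot(f(p)-p)>0$, or ($f(p)=p$ and $\sigma_2\cdot\pi(f)>0$). *)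

theory Defs
  imports Complex_Main "HOL-Algebra.Group"
begin

definition partial_left_order :: "('a, 'b) monoid_scheme \<Rightarrow> 'a rel \<Rightarrow> bool" where
  "partial_left_order G r \<longleftrightarrow>
     partial_order_on (carrier G) r \<and>
     (\<forall>a\<in>carrier G. \<forall>b\<in>carrier G. \<forall>c\<in>carrier G.
        (a, b) \<in> r \<longrightarrow> (c \<otimes>\<^bsub>G\<^esub> a, c \<otimes>\<^bsub>G\<^esub> b) \<in> r)"

definition left_order :: "('a, 'b) monoid_scheme \<Rightarrow> 'a rel \<Rightarrow> bool" where
  "left_order G r \<longleftrightarrow> partial_left_order G r \<and> total_on (carrier G) r"

definition positive_cone :: "('a, 'b) monoid_scheme \<Rightarrow> 'a rel \<Rightarrow> 'a set" where
  "positive_cone G r = {a \<in> carrier G. (\<one>\<^bsub>G\<^esub>, a) \<in> r \<and> a \<noteq> \<one>\<^bsub>G\<^esub>}"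

text \<open>The order \<open>s\<close> extends the order \<open>r\<close>.\<close>

definition order_extends :: "('a, 'b) monoid_scheme \<Rightarrow> 'a rel \<Rightarrow> 'a rel \<Rightarrow> bool" where
  "order_extends G s r \<longleftrightarrow> positive_cone G r \<subseteq> positive_cone G s"

definition fully_left_orderable :: "('a, 'b) monoid_scheme \<Rightarrow> bool" where
  "fully_left_orderable G \<longleftrightarrow>
     (\<forall>r. partial_left_order G r \<longrightarrow> (\<exists>s. left_order G s \<and> order_extends G s r))"

text \<open>The subring \<open>\<int>[lam, 1/lam]\<close> of \<open>\<rat>\<close>, as the set of values at \<open>lam\<close> of integer Laurent polynomials.\<close>

definition int_laurent_ring :: "rat \<Rightarrow> rat set" where
  "int_laurent_ring lam =
     {c. \<exists>(I :: int set) (a :: int \<Rightarrow> int). finite I \<and> c = (\<Sum>i\<in>I. of_int (a i) * lam powi i)}"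

definition affine_group :: "rat \<Rightarrow> (rat \<Rightarrow> rat) monoid" where
  "affine_group lam =
     \<lparr>carrier = {f. \<exists>(n :: int). \<exists>c\<in>int_laurent_ring lam. f = (\<lambda>x. lam powi n * x + c)},
      monoid.mult = (\<circ>), one = id\<rparr>"

definition exponent :: "rat \<Rightarrow> (rat \<Rightarrow> rat) \<Rightarrow> int" where
  "exponent lam f = (THE n. \<exists>c\<in>int_laurent_ring lam. f = (\<lambda>x. lam powi n * x + c))"

text \<open>An element \<open>f\<close> of the group, regarded as an affine map of \<open>\<real>\<close>; the translation part is \<open>f 0\<close>.\<close>

definition real_action :: "rat \<Rightarrow> (rat \<Rightarrow> rat) \<Rightarrow> real \<Rightarrow> real" where
  "real_action lam f x = of_rat lam powi exponent lam f * x + of_rat (f 0)"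

text \<open>Signs are represented by the integers \<open>1\<close> and \<open>-1\<close>.\<close>

definition is_type1 :: "rat \<Rightarrow> (rat \<Rightarrow> rat) rel \<Rightarrow> bool" where
  "is_type1 lam r \<longleftrightarrow> left_order (affine_group lam) r \<and>
     (\<exists>\<sigma>1\<in>{1, -1 :: int}. \<exists>\<sigma>2\<in>{1, -1 :: int}.
        positive_cone (affine_group lam) r =
          {f \<in> carrier (affine_group lam).
             \<sigma>1 * exponent lam f > 0 \<or> (exponent lam f = 0 \<and> of_int \<sigma>2 * f 0 > 0)})"

definition is_type2 :: "rat \<Rightarrow> (rat \<Rightarrow> rat) rel \<Rightarrow> bool" where
  "is_type2 lam r \<longleftrightarrow> left_order (affine_group lam) r \<and>
     (\<exists>(p :: real). \<exists>\<sigma>1\<in>{1, -1 :: int}. \<exists>\<sigma>2\<in>{1, -1 :: int}.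
        positive_cone (affine_group lam) r =
          {f \<in> carrier (affine_group lam).
             of_int \<sigma>1 * (real_action lam f p - p) > 0 \<or>
             (real_action lam f p = p \<and> \<sigma>2 * exponent lam f > 0)})"

lemma exponent_eq:
  assumes "lam > 1" and "c \<in> int_laurent_ring lam"
  shows "exponent lam (\<lambda>x. lam powi n * x + c) = n"
  unfolding exponent_def
proof (rule the_equality)
  show "\<exists>d\<in>int_laurent_ring lam. (\<lambda>x. lam powi n * x + c) = (\<lambda>x. lam powi n * x + d)"
    using assms by blast
next
  fix m assume "\<exists>d\<in>int_laurent_ring lam. (\<lambda>x. lam powi n * x + c) = (\<lambda>x. lam powi m * x + d)"
  then obtain d where d: "\<And>x. lam powi n * x + c = lam powi m * x + d" by metis
  from d[of 0] d[of 1] have eq: "lam powi n = lam powi m" by simp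
  show "m = n"
    using power_int_strict_increasing[OF _ assms(1)] eq by (metis less_irrefl linorder_neqE)
qed

lemma real_action_of_rat:
  assumes "lam > 1" and "f \<in> carrier (affine_group lam)"
  shows "real_action lam f (of_rat q) = of_rat (f q)"
proof -
  obtain n c where "c \<in> int_laurent_ring lam" and f: "f = (\<lambda>x. lam powi n * x + c)"
    using assms(2) by (auto simp: affine_group_def)
  then have n: "exponent lam f = n"
    using exponent_eq assms(1) by simp
  have "(of_rat (lam powi n) :: real) = of_rat lam powi n"
    by (simp add: power_int_def of_rat_power of_rat_inverse)
  then show ?thesis
    unfolding real_action_def n by (simp add: f of_rat_add of_rat_mult)
qed

lemma int_laurent_ring_add:
  assumes "c \<in> int_laurent_ring lam" and "d \<in> int_laurent_ring lam"
  shows "c + d \<in> int_laurent_ring lam"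
proof -
  obtain I a where I: "finite I" "c = (\<Sum>i\<in>I. of_int (a i) * lam powi i)"
    using assms(1) by (auto simp: int_laurent_ring_def)
  obtain J b where J: "finite J" "d = (\<Sum>i\<in>J. of_int (b i) * lam powi i)"
    using assms(2) by (auto simp: int_laurent_ring_def)
  let ?a = "\<lambda>i. if i \<in> I then a i else 0" and ?b = "\<lambda>i. if i \<in> J then b i else 0"
  have "c = (\<Sum>i\<in>I \<union> J. of_int (?a i) * lam powi i)"
    unfolding I(2) using I(1) J(1) by (intro sum.mono_neutral_cong_left) auto
  moreover have "d = (\<Sum>i\<in>I \<union> J. of_int (?b i) * lam powi i)"
    unfolding J(2) using I(1) J(1) by (intro sum.mono_neutral_cong_left) auto
  ultimately have "c + d = (\<Sum>i\<in>I \<union> J. of_int (?a i + ?b i) * lam powi i)"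
    by (simp only: of_int_add distrib_right sum.distrib)
  then show ?thesis
    using I(1) J(1) unfolding int_laurent_ring_def
    by (intro CollectI exI[of _ "I \<union> J"] exI[of _ "\<lambda>i. ?a i + ?b i"]) auto
qed

lemma int_laurent_ring_minus:
  assumes "c \<in> int_laurent_ring lam"
  shows "- c \<in> int_laurent_ring lam"
proof -
  obtain I a where I: "finite I" "c = (\<Sum>i\<in>I. of_int (a i) * lam powi i)"
    using assms by (auto simp: int_laurent_ring_def)
  then have "- c = (\<Sum>i\<in>I. of_int (- a i) * lam powi i)"
    by (simp add: sum_negf)
  then show ?thesis
    using I(1) unfolding int_laurent_ring_def
    by (intro CollectI exI[of _ I] exI[of _ "\<lambda>i. - a i"]) auto
qed

lemma int_laurent_ring_powi_mult:
  assumes "lam \<noteq> 0" and "c \<in> int_laurent_ring lam"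
  shows "lam powi n * c \<in> int_laurent_ring lam"
proof -
  obtain I a where I: "finite I" "c = (\<Sum>i\<in>I. of_int (a i) * lam powi i)"
    using assms(2) by (auto simp: int_laurent_ring_def)
  have "lam powi n * c = (\<Sum>i\<in>I. of_int (a i) * lam powi (n + i))"
    unfolding I(2) sum_distrib_left
    by (intro sum.cong) (simp_all add: power_int_add assms(1))
  also have "\<dots> = (\<Sum>j\<in>(+) n ` I. of_int (a (j - n)) * lam powi j)"
    by (subst sum.reindex) (auto simp: inj_on_def)
  finally show ?thesis
    using I(1) unfolding int_laurent_ring_def
    by (intro CollectI exI[of _ "(+) n ` I"] exI[of _ "\<lambda>j. a (j - n)"]) auto
qed

lemma affine_groupI:
  assumes "c \<in> int_laurent_ring lam"
  shows "(\<lambda>x. lam powi n * x + c) \<in> carrier (affine_group lam)"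
  using assms by (auto simp: affine_group_def)

lemma group_affine_group:
  assumes "lam > 1"
  shows "group (affine_group lam)"
proof (rule groupI)
  have nz: "lam \<noteq> 0" using assms by simp
  fix f assume "f \<in> carrier (affine_group lam)"
  then obtain n c where f: "f = (\<lambda>x. lam powi n * x + c)" and c: "c \<in> int_laurent_ring lam"
    by (auto simp: affine_group_def)
  let ?g = "\<lambda>x. lam powi (- n) * x + - (lam powi (- n) * c)"
  have "?g \<in> carrier (affine_group lam)"
    by (intro affine_groupI int_laurent_ring_minus int_laurent_ring_powi_mult nz c)
  moreover have "?g \<otimes>\<^bsub>affine_group lam\<^esub> f = \<one>\<^bsub>affine_group lam\<^esub>"
    using nz by (simp add: affine_group_def f fun_eq_iff power_int_minus distrib_left)
  ultimately show "\<exists>g\<in>carrier (affine_group lam). g \<otimes>\<^bsub>affine_group lam\<^esub> f = \<one>\<^bsub>affine_group lam\<^esub>"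
    by blast
  fix g assume "g \<in> carrier (affine_group lam)"
  then obtain m d where g: "g = (\<lambda>x. lam powi m * x + d)" and d: "d \<in> int_laurent_ring lam"
    by (auto simp: affine_group_def)
  have "f \<circ> g = (\<lambda>x. lam powi (n + m) * x + (lam powi n * d + c))"
    using nz by (simp add: f g fun_eq_iff power_int_add distrib_left)
  then show "f \<otimes>\<^bsub>affine_group lam\<^esub> g \<in> carrier (affine_group lam)"
    using affine_groupI[OF int_laurent_ring_add[OF int_laurent_ring_powi_mult[OF nz d] c]]
    by (simp add: affine_group_def)
next
  have "0 \<in> int_laurent_ring lam"
    unfolding int_laurent_ring_def by (intro CollectI exI[of _ "{}"]) auto
  then show "\<one>\<^bsub>affine_group lam\<^esub> \<in> carrier (affine_group lam)"
    using affine_groupI[of 0 lam 0] by (simp add: affine_group_def id_def)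
qed (simp_all add: affine_group_def comp_assoc)

end

theory Submission
  imports Defs
begin

text \<open>
  The positive cone \<open>P\<close> of a partial left-order is a subsemigroup without the identity.  Since the
  translation parts are rational, hence pairwise commensurable, the translations in \<open>P\<close> all go in
  the same direction.  If the nonzero exponents occurring in \<open>P\<close> have constant sign, \<open>P\<close> lies in a
  cone of type (1).  Otherwise take any \<open>f\<close> in \<open>P\<close> expanding with fixed point \<open>a\<close> and any \<open>g\<close> in
  \<open>P\<close> contracting with fixed point \<open>b\<close>: suitable powers of them have inverse slopes \<open>L\<close> and
  \<open>1/L\<close>, and their composition is the translation by \<open>(L - 1) (b - a)\<close>.  So \<open>b - a\<close> is nonzero and
  its sign is that of all translations in \<open>P\<close>; a real number \<open>p\<close> separating the fixed points of
  the expanding elements from those of the contracting ones gives a cone of type (2) containing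
  \<open>P\<close>.
\<close>

section \<open>Cones and left-orders in an arbitrary group\<close>

text \<open>The positive cones of left-orders, described without an order. That \<open>a\<close> and
  its inverse cannot both lie in \<open>C\<close> follows from closure under products and the
  absence of the identity.\<close>

definition left_order_cone :: "('a, 'b) monoid_scheme \<Rightarrow> 'a set \<Rightarrow> bool" where
  "left_order_cone G C \<longleftrightarrow> C \<subseteq> carrier G \<and> \<one>\<^bsub>G\<^esub> \<notin> C \<and>
     (\<forall>a\<in>C. \<forall>b\<in>C. a \<otimes>\<^bsub>G\<^esub> b \<in> C) \<and>
     (\<forall>a\<in>carrier G. a \<noteq> \<one>\<^bsub>G\<^esub> \<longrightarrow> a \<in> C \<or> inv\<^bsub>G\<^esub> a \<in> C)"

definition cone_order :: "('a, 'b) monoid_scheme \<Rightarrow> 'a set \<Rightarrow> 'a rel" where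
  "cone_order G C = {(a, b). a \<in> carrier G \<and> b \<in> carrier G \<and> (a = b \<or> inv\<^bsub>G\<^esub> a \<otimes>\<^bsub>G\<^esub> b \<in> C)}"

context group
begin

text \<open>Left translation by \<open>a\<close> turns \<open>1 \<le> b\<close> into
  \<open>a \<le> ab\<close>, so \<open>1 \<le> a \<le> ab\<close>. If \<open>ab\<close> were the
  identity, antisymmetry would force \<open>a\<close> to be the identity as well.\<close>

lemma positive_cone_mult:
  assumes r: "partial_left_order G r" and a: "a \<in> positive_cone G r" and b: "b \<in> positive_cone G r"
  shows "a \<otimes> b \<in> positive_cone G r"
proof -
  have t: "trans r" and as: "antisym r"
    using r by (auto simp: partial_left_order_def partial_order_on_def preorder_on_def)
  have ab: "a \<in> carrier G" "b \<in> carrier G" "(\<one>, a) \<in> r" "(\<one>, b) \<in> r" "a \<noteq> \<one>"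
    using a b by (auto simp: positive_cone_def)
  have "(a \<otimes> \<one>, a \<otimes> b) \<in> r"
    using r ab unfolding partial_left_order_def by blast
  then have 1: "(a, a \<otimes> b) \<in> r" using ab by simp
  then have "(\<one>, a \<otimes> b) \<in> r" using t ab(3) by (blast dest: transD)
  moreover have "a \<otimes> b \<noteq> \<one>"
    using 1 ab as by (auto dest: antisymD)
  ultimately show ?thesis
    using ab by (simp add: positive_cone_def)
qed

text \<open>Transitivity and antisymmetry both come from the telescoping product
  \<open>chain\<close>. Invariance holds because a left factor cancels in
  \<open>inv a \<otimes> b\<close>, and totality because inverting this element swaps
  \<open>a\<close> and \<open>b\<close>.\<close>

lemma left_order_cone_order:
  assumes C: "left_order_cone G C"
  shows "left_order G (cone_order G C)"
proof -
  have sub: "x \<in> carrier G" if "x \<in> C" for x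
    using C that by (auto simp: left_order_cone_def)
  have one: "\<one> \<notin> C" and mult: "\<And>x y. x \<in> C \<Longrightarrow> y \<in> C \<Longrightarrow> x \<otimes> y \<in> C"
    and tot: "\<And>x. x \<in> carrier G \<Longrightarrow> x \<noteq> \<one> \<Longrightarrow> x \<in> C \<or> inv x \<in> C"
    using C by (auto simp: left_order_cone_def)
  have chain: "(inv a \<otimes> b) \<otimes> (inv b \<otimes> c) = inv a \<otimes> c"
    if "a \<in> carrier G" "b \<in> carrier G" "c \<in> carrier G" for a b c
    using that by (metis inv_closed inv_solve_left m_assoc m_closed)
  have "refl_on (carrier G) (cone_order G C)"
    by (auto simp: refl_on_def cone_order_def)
  moreover have "cone_order G C \<subseteq> carrier G \<times> carrier G"
    by (auto simp: cone_order_def)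
  moreover have "trans (cone_order G C)"
  proof (rule transI)
    fix a b c assume "(a, b) \<in> cone_order G C" "(b, c) \<in> cone_order G C"
    then show "(a, c) \<in> cone_order G C"
      using mult[of "inv a \<otimes> b" "inv b \<otimes> c"] chain[of a b c] by (auto simp: cone_order_def)
  qed
  moreover have "antisym (cone_order G C)"
  proof (rule antisymI)
    fix a b assume "(a, b) \<in> cone_order G C" "(b, a) \<in> cone_order G C"
    then show "a = b"
      using mult[of "inv a \<otimes> b" "inv b \<otimes> a"] chain[of a b a] one by (auto simp: cone_order_def)
  qed
  moreover have "(c \<otimes> a, c \<otimes> b) \<in> cone_order G C"
    if "a \<in> carrier G" "b \<in> carrier G" "c \<in> carrier G" "(a, b) \<in> cone_order G C" for a b c
  proof -
    have "inv (c \<otimes> a) \<otimes> (c \<otimes> b) = inv a \<otimes> b"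
      using that(1-3) by (simp add: inv_mult_group m_assoc inv_solve_left')
    then show ?thesis using that by (auto simp: cone_order_def)
  qed
  moreover have "total_on (carrier G) (cone_order G C)"
  proof (rule total_onI)
    fix a b assume ab: "a \<in> carrier G" "b \<in> carrier G" "a \<noteq> b"
    then have "inv a \<otimes> b \<noteq> \<one>" by (metis inv_closed inv_equality inv_inv)
    moreover have "inv (inv a \<otimes> b) = inv b \<otimes> a" using ab by (simp add: inv_mult_group)
    ultimately show "(a, b) \<in> cone_order G C \<or> (b, a) \<in> cone_order G C"
      using tot[of "inv a \<otimes> b"] ab by (auto simp: cone_order_def)
  qed
  ultimately show ?thesis
    by (auto simp: left_order_def partial_left_order_def partial_order_on_def preorder_on_def)
qed

lemma positive_cone_order:
  assumes "left_order_cone G C"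
  shows "positive_cone G (cone_order G C) = C"
  using assms by (auto simp: positive_cone_def cone_order_def left_order_cone_def subset_iff)

text \<open>Cones of left-orders are maximal: an element of \<open>C\<close> missing from the cone
  of \<open>r\<close> would have its inverse there, hence in \<open>C\<close>, and the product would
  put the identity into \<open>C\<close>.\<close>

lemma positive_cone_eq:
  assumes r: "left_order G r" and C: "left_order_cone G C" and le: "positive_cone G r \<subseteq> C"
  shows "positive_cone G r = C"
proof (rule subset_antisym[OF le], rule subsetI)
  fix a assume aC: "a \<in> C"
  then have a: "a \<in> carrier G" "a \<noteq> \<one>" using C by (auto simp: left_order_cone_def)
  have p: "partial_left_order G r" and t: "total_on (carrier G) r"
    using r by (auto simp: left_order_def)
  show "a \<in> positive_cone G r"
  proof (rule ccontr)
    assume "a \<notin> positive_cone G r"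
    then have "(a, \<one>) \<in> r" using t a by (auto simp: total_on_def positive_cone_def)
    then have "(inv a \<otimes> a, inv a \<otimes> \<one>) \<in> r"
      using p a unfolding partial_left_order_def by blast
    then have "inv a \<in> C" using le a by (auto simp: positive_cone_def)
    then have "a \<otimes> inv a \<in> C" using C aC by (auto simp: left_order_cone_def)
    then show False using C a by (auto simp: left_order_cone_def)
  qed
qed

end

section \<open>The two families of cones\<close>

definition type1_cone :: "rat \<Rightarrow> int \<Rightarrow> int \<Rightarrow> (rat \<Rightarrow> rat) set" where
  "type1_cone lam \<sigma>1 \<sigma>2 = {f \<in> carrier (affine_group lam).
     \<sigma>1 * exponent lam f > 0 \<or> (exponent lam f = 0 \<and> of_int \<sigma>2 * f 0 > 0)}"

definition type2_cone :: "rat \<Rightarrow> real \<Rightarrow> int \<Rightarrow> int \<Rightarrow> (rat \<Rightarrow> rat) set" where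
  "type2_cone lam p \<sigma>1 \<sigma>2 = {f \<in> carrier (affine_group lam).
     of_int \<sigma>1 * (real_action lam f p - p) > 0 \<or>
     (real_action lam f p = p \<and> \<sigma>2 * exponent lam f > 0)}"

text \<open>Meaningful only for nonzero exponent; otherwise the value is \<open>0\<close>.\<close>

definition fixed_point :: "rat \<Rightarrow> (rat \<Rightarrow> rat) \<Rightarrow> rat" where
  "fixed_point lam f = f 0 / (1 - lam powi exponent lam f)"

text \<open>The supremum of \<open>A\<close> separates. It can be irrational even when all elements
  of \<open>A\<close> and \<open>B\<close> are rational, so \<open>p\<close> has to range over the
  reals.\<close>

lemma exists_separating:
  fixes A B :: "real set"
  assumes "A \<noteq> {}" "B \<noteq> {}" "\<And>a b. a \<in> A \<Longrightarrow> b \<in> B \<Longrightarrow> a < b"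
  obtains p where "\<And>a. a \<in> A \<Longrightarrow> a \<le> p" "\<And>b. b \<in> B \<Longrightarrow> p \<le> b"
proof
  have "bdd_above A" using assms(2,3) by (meson all_not_in_conv bdd_aboveI less_imp_le)
  then show "a \<le> Sup A" if "a \<in> A" for a using that by (simp add: cSup_upper)
  show "Sup A \<le> b" if "b \<in> B" for b
    using assms(1,3) that by (intro cSup_least) (auto intro: less_imp_le)
qed

lemma of_rat_powi: "(of_rat (x powi n) :: real) = of_rat x powi n"
  by (simp add: power_int_def of_rat_power of_rat_inverse)

context
  fixes lam :: rat
  assumes lam: "lam > 1"
begin

interpretation group "affine_group lam"
  by (rule group_affine_group[OF lam])

section \<open>Exponents and the action on the real line\<close>

lemma carrier_apply:
  assumes "f \<in> carrier (affine_group lam)"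
  shows "f x = lam powi exponent lam f * x + f 0"
proof -
  obtain n c where c: "c \<in> int_laurent_ring lam" and f: "f = (\<lambda>x. lam powi n * x + c)"
    using assms by (auto simp: affine_group_def)
  then show ?thesis using exponent_eq[OF lam c, of n] by simp
qed

lemma comp_closed:
  assumes "f \<in> carrier (affine_group lam)" "g \<in> carrier (affine_group lam)"
  shows "f \<circ> g \<in> carrier (affine_group lam)"
  using m_closed[OF assms] by (simp add: affine_group_def)

lemma powi_eq_iff: "lam powi m = lam powi n \<longleftrightarrow> m = n"
  using power_int_strict_increasing[OF _ lam] by (metis less_irrefl linorder_neqE)

text \<open>The slope of an affine map is its value at \<open>1\<close> minus its value at
  \<open>0\<close>. Slopes multiply under composition, and \<open>lam powi n\<close> determines
  \<open>n\<close>.\<close>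

lemma exponent_comp:
  assumes f: "f \<in> carrier (affine_group lam)" and g: "g \<in> carrier (affine_group lam)"
  shows "exponent lam (f \<circ> g) = exponent lam f + exponent lam g"
proof -
  have "lam powi exponent lam (f \<circ> g) = (f \<circ> g) 1 - (f \<circ> g) 0"
    using carrier_apply[OF comp_closed[OF f g], of 1] by simp
  also have "\<dots> = lam powi exponent lam f * (g 1 - g 0)"
    using carrier_apply[OF f, of "g 1"] carrier_apply[OF f, of "g 0"] by (simp add: algebra_simps)
  also have "\<dots> = lam powi (exponent lam f + exponent lam g)"
    using carrier_apply[OF g, of 1] lam by (simp add: power_int_add)
  finally show ?thesis by (simp add: powi_eq_iff)
qed

lemma id_closed: "id \<in> carrier (affine_group lam)"
  using one_closed by (simp add: affine_group_def)

lemma exponent_id: "exponent lam id = 0"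
  using exponent_comp[OF id_closed id_closed] by simp

lemma eq_id:
  assumes "f \<in> carrier (affine_group lam)" "exponent lam f = 0" "f 0 = 0"
  shows "f = id"
  using carrier_apply[OF assms(1)] assms(2,3) by (auto simp: fun_eq_iff)

lemma real_action_comp:
  assumes f: "f \<in> carrier (affine_group lam)" and g: "g \<in> carrier (affine_group lam)"
  shows "real_action lam (f \<circ> g) x = real_action lam f (real_action lam g x)"
proof -
  have "(of_rat (f (g 0)) :: real) = of_rat lam powi exponent lam f * of_rat (g 0) + of_rat (f 0)"
    using carrier_apply[OF f, of "g 0"] by (simp add: of_rat_add of_rat_mult of_rat_powi)
  then show ?thesis
    using lam by (simp add: real_action_def exponent_comp[OF f g] power_int_add algebra_simps)
qed

lemma real_action_id: "real_action lam id x = x"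
  by (simp add: real_action_def exponent_id)

lemma real_action_less_iff: "real_action lam f x < real_action lam f y \<longleftrightarrow> x < y"
  using lam by (simp add: real_action_def)

lemma inv_comp:
  assumes "f \<in> carrier (affine_group lam)"
  shows "f \<circ> inv\<^bsub>affine_group lam\<^esub> f = id" "inv\<^bsub>affine_group lam\<^esub> f \<in> carrier (affine_group lam)"
  using r_inv[OF assms] inv_closed[OF assms] by (simp_all add: affine_group_def)

lemma exponent_inv:
  assumes f: "f \<in> carrier (affine_group lam)"
  shows "exponent lam (inv\<^bsub>affine_group lam\<^esub> f) = - exponent lam f"
  using exponent_comp[OF f inv_comp(2)[OF f]] by (simp add: inv_comp(1)[OF f] exponent_id)

section \<open>Both families consist of cones of left-orders\<close>

text \<open>A lexicographic order: the exponent is a homomorphism to the integers, and evaluation at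
  \<open>0\<close> is an injective homomorphism on its kernel.\<close>

lemma left_order_cone_type1:
  assumes s: "\<sigma>1 \<in> {1, -1}" "\<sigma>2 \<in> {1, -1}"
  shows "left_order_cone (affine_group lam) (type1_cone lam \<sigma>1 \<sigma>2)"
  unfolding left_order_cone_def
proof (intro conjI ballI impI)
  show "type1_cone lam \<sigma>1 \<sigma>2 \<subseteq> carrier (affine_group lam)"
    by (auto simp: type1_cone_def)
  show "\<one>\<^bsub>affine_group lam\<^esub> \<notin> type1_cone lam \<sigma>1 \<sigma>2"
    by (auto simp: type1_cone_def affine_group_def exponent_id[simplified])
next
  fix f g assume fg: "f \<in> type1_cone lam \<sigma>1 \<sigma>2" "g \<in> type1_cone lam \<sigma>1 \<sigma>2"
  then have c: "f \<in> carrier (affine_group lam)" "g \<in> carrier (affine_group lam)"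
    by (auto simp: type1_cone_def)
  have "f (g 0) = g 0 + f 0" if "exponent lam f = 0"
    using carrier_apply[OF c(1), of "g 0"] that by simp
  then have "f \<circ> g \<in> type1_cone lam \<sigma>1 \<sigma>2"
    using fg s exponent_comp[OF c] comp_closed[OF c] by (auto simp: type1_cone_def)
  then show "f \<otimes>\<^bsub>affine_group lam\<^esub> g \<in> type1_cone lam \<sigma>1 \<sigma>2"
    by (simp add: affine_group_def)
next
  fix f assume f: "f \<in> carrier (affine_group lam)" "f \<noteq> \<one>\<^bsub>affine_group lam\<^esub>"
  let ?g = "inv\<^bsub>affine_group lam\<^esub> f"
  have "f 0 \<noteq> 0" if "exponent lam f = 0"
    using eq_id[OF f(1) that] f(2) by (auto simp: affine_group_def)
  moreover have "?g 0 = - f 0" if "exponent lam f = 0"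
    using carrier_apply[OF f(1), of "?g 0"] fun_cong[OF inv_comp(1)[OF f(1)], of 0] that by simp
  ultimately show "f \<in> type1_cone lam \<sigma>1 \<sigma>2 \<or> ?g \<in> type1_cone lam \<sigma>1 \<sigma>2"
    using s f(1) exponent_inv[OF f(1)] inv_comp(2)[OF f(1)]
    by (auto simp: type1_cone_def)
qed

text \<open>Elements are compared by where they send \<open>p\<close>, ties being broken by the
  exponent. An element fixing \<open>p\<close> with exponent zero is the identity, so no tie
  remains.\<close>

lemma left_order_cone_type2:
  assumes s: "\<sigma>1 \<in> {1, -1}" "\<sigma>2 \<in> {1, -1}"
  shows "left_order_cone (affine_group lam) (type2_cone lam p \<sigma>1 \<sigma>2)"
  unfolding left_order_cone_def
proof (intro conjI ballI impI)
  show "type2_cone lam p \<sigma>1 \<sigma>2 \<subseteq> carrier (affine_group lam)"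
    by (auto simp: type2_cone_def)
  show "\<one>\<^bsub>affine_group lam\<^esub> \<notin> type2_cone lam p \<sigma>1 \<sigma>2"
    using exponent_id real_action_id by (auto simp: type2_cone_def affine_group_def)
next
  fix f g assume fg: "f \<in> type2_cone lam p \<sigma>1 \<sigma>2" "g \<in> type2_cone lam p \<sigma>1 \<sigma>2"
  then have c: "f \<in> carrier (affine_group lam)" "g \<in> carrier (affine_group lam)"
    by (auto simp: type2_cone_def)
  \<comment> \<open>For \<open>\<sigma>1 = 1\<close>, monotonicity of \<open>f\<close> carries
    \<open>g p \<ge> p\<close> to \<open>f (g p) \<ge> f p \<ge> p\<close>; equality throughout
    means that both maps fix \<open>p\<close>, and then the exponents add.\<close>
  have "f \<circ> g \<in> type2_cone lam p \<sigma>1 \<sigma>2"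
    using fg s exponent_comp[OF c] comp_closed[OF c] real_action_comp[OF c, of p]
      real_action_less_iff[of f "real_action lam g p" p] real_action_less_iff[of f p "real_action lam g p"]
    by (auto simp: type2_cone_def)
  then show "f \<otimes>\<^bsub>affine_group lam\<^esub> g \<in> type2_cone lam p \<sigma>1 \<sigma>2"
    by (simp add: affine_group_def)
next
  fix f assume f: "f \<in> carrier (affine_group lam)" "f \<noteq> \<one>\<^bsub>affine_group lam\<^esub>"
  let ?g = "inv\<^bsub>affine_group lam\<^esub> f"
  have fp: "real_action lam f (real_action lam ?g p) = p"
    using real_action_comp[OF f(1) inv_comp(2)[OF f(1)], of p]
    by (simp add: inv_comp(1)[OF f(1)] real_action_id)
  have "exponent lam f \<noteq> 0" if "real_action lam f p = p"
    using eq_id[OF f(1)] f(2) that by (auto simp: affine_group_def real_action_def)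
  \<comment> \<open>The increasing map \<open>f\<close> sends \<open>?g p\<close> to
    \<open>p\<close>, so \<open>f\<close> and its inverse move \<open>p\<close> in opposite
    directions.\<close>
  moreover have "real_action lam ?g p < p \<longleftrightarrow> p < real_action lam f p"
    "p < real_action lam ?g p \<longleftrightarrow> real_action lam f p < p"
    using real_action_less_iff[of f "real_action lam ?g p" p]
      real_action_less_iff[of f p "real_action lam ?g p"] fp by auto
  ultimately show "f \<in> type2_cone lam p \<sigma>1 \<sigma>2 \<or> ?g \<in> type2_cone lam p \<sigma>1 \<sigma>2"
    using s f(1) exponent_inv[OF f(1)] inv_comp(2)[OF f(1)]
    by (auto simp: type2_cone_def)
qed

section \<open>Dilations about fixed points\<close>

lemma apply_fixed_point:
  assumes "f \<in> carrier (affine_group lam)" "exponent lam f \<noteq> 0"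
  shows "f x = lam powi exponent lam f * (x - fixed_point lam f) + fixed_point lam f"
proof -
  have "1 - lam powi exponent lam f \<noteq> 0"
    using powi_eq_iff[of "exponent lam f" 0] assms(2) by simp
  then have "f 0 = fixed_point lam f * (1 - lam powi exponent lam f)"
    by (simp add: fixed_point_def)
  then show ?thesis using carrier_apply[OF assms(1), of x] by (simp add: algebra_simps)
qed

text \<open>Gives the sign of the displacement: an expanding element moves points away from its
  fixed point, a contracting one towards it.\<close>

lemma real_action_fixed_point:
  assumes f: "f \<in> carrier (affine_group lam)" "exponent lam f \<noteq> 0"
  shows "real_action lam f x - x =
    (of_rat lam powi exponent lam f - 1) * (x - of_rat (fixed_point lam f))"
proof -
  have "(of_rat (f 0) :: real) =
      of_rat lam powi exponent lam f * (- of_rat (fixed_point lam f)) + of_rat (fixed_point lam f)"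
    using apply_fixed_point[OF f, of 0] by (simp add: of_rat_add of_rat_mult of_rat_minus of_rat_diff of_rat_powi)
  then show ?thesis by (simp add: real_action_def algebra_simps)
qed

section \<open>Subsemigroups that avoid the identity\<close>

context
  fixes P :: "(rat \<Rightarrow> rat) set"
  assumes sub: "P \<subseteq> carrier (affine_group lam)"
    and comp: "\<And>f g. f \<in> P \<Longrightarrow> g \<in> P \<Longrightarrow> f \<circ> g \<in> P"
    and id: "id \<notin> P"
begin

lemma funpow_mem:
  assumes "f \<in> P" "k > 0"
  shows "f ^^ k \<in> P"
  using assms(2)
proof (induction k rule: nat_induct_non_zero)
  case 1
  then show ?case using assms by simp
next
  case (Suc k)
  then show ?case using comp[OF assms(1), of "f ^^ k"] by (simp add: comp_def)
qed

lemma exponent_funpow: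
  assumes "f \<in> P" "k > 0"
  shows "exponent lam (f ^^ k) = int k * exponent lam f"
  using assms(2)
proof (induction k rule: nat_induct_non_zero)
  case 1
  then show ?case by simp
next
  case (Suc k)
  have "exponent lam (f \<circ> f ^^ k) = exponent lam f + exponent lam (f ^^ k)"
    using sub assms(1) funpow_mem[OF assms(1) Suc(1)] by (intro exponent_comp) auto
  then show ?case using Suc by (simp add: algebra_simps comp_def)
qed

lemma translation_nonzero:
  assumes "f \<in> P" "exponent lam f = 0"
  shows "f 0 \<noteq> 0"
  using eq_id assms sub id by blast

text \<open>If the translations went in opposite directions, writing the ratio of their lengths as a
  fraction of positive integers would give positive powers of \<open>f\<close> and \<open>g\<close>
  that compose to the identity.\<close>

lemma translations_same_sign:
  assumes f: "f \<in> P" "exponent lam f = 0" and g: "g \<in> P" "exponent lam g = 0"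
    and pos: "f 0 > 0"
  shows "g 0 > 0"
proof (rule ccontr)
  assume "\<not> g 0 > 0"
  then have neg: "g 0 < 0" using translation_nonzero[OF g] by simp
  obtain a b where ab: "- g 0 / f 0 = of_int a / of_int b" "b > 0"
    by (metis quotient_of_div quotient_of_denom_pos' surjective_pairing)
  have "of_int a / of_int b > (0 :: rat)"
    unfolding ab(1)[symmetric] using pos neg by (simp add: divide_neg_pos)
  then have a: "a > 0" using ab(2) by (simp add: zero_less_divide_iff)
  have app: "(h ^^ k) x = x + of_nat k * h 0" if "h \<in> P" "exponent lam h = 0" for h x k
  proof (induction k)
    case (Suc k)
    have "h ((h ^^ k) x) = (h ^^ k) x + h 0"
      using carrier_apply[of h "(h ^^ k) x"] that sub by auto
    then show ?case using Suc by (simp add: algebra_simps)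
  qed simp
  have "of_int a * f 0 + of_int b * g 0 = 0"
    using ab pos by (simp add: field_simps)
  then have "f ^^ nat a \<circ> g ^^ nat b = id"
    using a ab(2) by (auto simp: fun_eq_iff app f g)
  then show False using id comp[OF funpow_mem[OF f(1), of "nat a"] funpow_mem[OF g(1), of "nat b"]]
    a ab(2) by auto
qed

lemma fixed_points_translation:
  assumes f: "f \<in> P" "exponent lam f > 0" and g: "g \<in> P" "exponent lam g < 0"
  obtains h c where "h \<in> P" "exponent lam h = 0" "c > 0"
    "h 0 = c * (fixed_point lam g - fixed_point lam f)"
proof -
  let ?a = "fixed_point lam f" and ?b = "fixed_point lam g"
  \<comment> \<open>Each element is raised to the absolute exponent of the other, which makes the
    exponents of the powers \<open>k\<close> and \<open>- k\<close>.\<close>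
  let ?m = "nat (- exponent lam g)" and ?n = "nat (exponent lam f)"
  let ?F = "f ^^ ?m" and ?G = "g ^^ ?n"
  define k where "k = exponent lam f * (- exponent lam g)"
  have k: "k > 0" unfolding k_def using f g by (simp add: mult_pos_neg)
  have FP: "?F \<in> P" and GP: "?G \<in> P" using funpow_mem f g by auto
  then have FG: "?F \<in> carrier (affine_group lam)" "?G \<in> carrier (affine_group lam)"
    using sub by auto
  have eF: "exponent lam ?F = k" and eG: "exponent lam ?G = - k"
    using exponent_funpow[OF f(1), of ?m] exponent_funpow[OF g(1), of ?n] f g
    by (simp_all add: k_def)
  have fix1: "(q ^^ j) x = x" if "q x = x" for q j and x :: rat
    using that by (induction j) auto
  have "f ?a = ?a" "g ?b = ?b"
    using apply_fixed_point[of f ?a] apply_fixed_point[of g ?b] f g sub by auto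
  \<comment> \<open>Powers keep the fixed point, which together with the slope determines an affine
    map.\<close>
  then have "?F ?a = ?a" "?G ?b = ?b" by (simp_all add: fix1)
  then have F: "?F x = lam powi k * (x - ?a) + ?a" and G: "?G x = lam powi (- k) * (x - ?b) + ?b" for x
    using carrier_apply[OF FG(1), of x] carrier_apply[OF FG(1), of ?a]
      carrier_apply[OF FG(2), of x] carrier_apply[OF FG(2), of ?b] eF eG
    by (simp_all add: algebra_simps)
  show ?thesis
  proof (rule that)
    show "?F \<circ> ?G \<in> P" by (rule comp[OF FP GP])
    show "exponent lam (?F \<circ> ?G) = 0" by (simp add: exponent_comp[OF FG] eF eG)
    \<comment> \<open>The constant \<open>c\<close> is chosen as
      \<open>lam powi k - 1\<close>.\<close>
    show "lam powi k - 1 > 0" using power_int_strict_increasing[OF k lam] by simp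
    have "lam powi k * (lam powi (- k) * y) = y" for y
      using lam by (simp add: power_int_minus)
    then have "lam powi k * (lam powi (- k) * (0 - ?b) + ?b - ?a) = - ?b + lam powi k * (?b - ?a)"
      by (metis (no_types, opaque_lifting) add_diff_eq diff_0 distrib_left)
    then show "(?F \<circ> ?G) 0 = (lam powi k - 1) * (?b - ?a)"
      unfolding comp_apply F G by (simp add: algebra_simps)
  qed
qed

text \<open>The sign \<open>\<sigma>2\<close> is the common direction of the translations in
  \<open>P\<close>.\<close>

lemma subset_type1_cone:
  assumes "\<sigma>1 \<in> {1, -1}" "\<And>f. f \<in> P \<Longrightarrow> \<sigma>1 * exponent lam f \<ge> 0"
  obtains \<sigma>2 where "\<sigma>2 \<in> {1, -1}" "P \<subseteq> type1_cone lam \<sigma>1 \<sigma>2"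
proof -
  have ex: "\<sigma>1 * exponent lam f > 0" if "f \<in> P" "exponent lam f \<noteq> 0" for f
    using assms(1) assms(2)[OF that(1)] that(2) by auto
  show ?thesis
  proof (cases "\<exists>f\<in>P. exponent lam f = 0 \<and> f 0 > 0")
    case True
    then have "P \<subseteq> type1_cone lam \<sigma>1 1"
      using ex translations_same_sign sub by (auto simp: type1_cone_def)
    then show ?thesis using that by blast
  next
    \<comment> \<open>This case includes a \<open>P\<close> without translations, for which
      \<open>-1\<close> is an arbitrary choice.\<close>
    case False
    then have "P \<subseteq> type1_cone lam \<sigma>1 (-1)"
      using ex translation_nonzero sub by (force simp: type1_cone_def)
    then show ?thesis using that by blast
  qed
qed

text \<open>Weak separation by \<open>p\<close> lets every element of \<open>P\<close> move
  \<open>p\<close> in direction \<open>\<sigma>1\<close> or fix it. The elements fixing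
  \<open>p\<close> have exponents of one sign, which becomes \<open>\<sigma>2\<close>.\<close>

lemma subset_type2_cone:
  assumes s: "\<sigma>1 \<in> {1, -1}"
    and trans: "\<And>f. f \<in> P \<Longrightarrow> exponent lam f = 0 \<Longrightarrow> of_int \<sigma>1 * f 0 > 0"
    and exp: "\<And>f. f \<in> P \<Longrightarrow> exponent lam f > 0 \<Longrightarrow>
      of_int \<sigma>1 * (p - of_rat (fixed_point lam f)) \<ge> 0"
    and contr: "\<And>f. f \<in> P \<Longrightarrow> exponent lam f < 0 \<Longrightarrow>
      of_int \<sigma>1 * (of_rat (fixed_point lam f) - p) \<ge> 0"
  obtains \<sigma>2 where "\<sigma>2 \<in> {1, -1}" "P \<subseteq> type2_cone lam p \<sigma>1 \<sigma>2"
proof -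
  have act: "of_int \<sigma>1 * (real_action lam f p - p) > 0 \<or>
      real_action lam f p = p \<and> exponent lam f \<noteq> 0 \<and> of_rat (fixed_point lam f) = p"
    if f: "f \<in> P" for f
  proof -
    have fc: "f \<in> carrier (affine_group lam)" using f sub by auto
    let ?u = "of_rat lam powi exponent lam f - 1 :: real"
    let ?v = "p - of_rat (fixed_point lam f)"
    have uv: "real_action lam f p - p = ?u * ?v" if "exponent lam f \<noteq> 0"
      by (rule real_action_fixed_point[OF fc that])
    consider "exponent lam f = 0" | "exponent lam f \<noteq> 0" "?v = 0" | "exponent lam f > 0" "?v \<noteq> 0"
      | "exponent lam f < 0" "?v \<noteq> 0"
      by linarith
    then show ?thesis
    proof cases
      case 1
      then show ?thesis using trans[OF f] s by (auto simp: real_action_def)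
    next
      case 2
      then show ?thesis using uv by simp
    next
      case 3
      have "?u > 0"
        using power_int_strict_increasing[OF 3(1), of "of_rat lam :: real"] lam by simp
      moreover have "of_int \<sigma>1 * ?v > 0" using exp[OF f 3(1)] 3(2) s by auto
      ultimately have "?u * (of_int \<sigma>1 * ?v) > 0" by (rule mult_pos_pos)
      then show ?thesis using uv 3(1) by (simp add: mult.left_commute)
    next
      case 4
      have "?u < 0"
        using power_int_strict_increasing[OF 4(1), of "of_rat lam :: real"] lam by simp
      moreover have "of_int \<sigma>1 * ?v < 0" using contr[OF f 4(1)] 4(2) s by auto
      ultimately have "?u * (of_int \<sigma>1 * ?v) > 0" by (rule mult_neg_neg)
      then show ?thesis using uv 4(1) by (simp add: mult.left_commute)
    qed
  qed
  \<comment> \<open>An expanding and a contracting element of \<open>P\<close> with the same fixed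
    point would produce a translation by zero in \<open>P\<close>.\<close>
  have opp: "\<not> (exponent lam f > 0 \<and> exponent lam g < 0)"
    if fg: "f \<in> P" "g \<in> P" and q: "of_rat (fixed_point lam f) = p" "of_rat (fixed_point lam g) = p"
    for f g
  proof
    assume e: "exponent lam f > 0 \<and> exponent lam g < 0"
    have "fixed_point lam f = fixed_point lam g" using q by (metis of_rat_eq_iff)
    moreover obtain h c where "h \<in> P" "exponent lam h = 0"
      "h 0 = c * (fixed_point lam g - fixed_point lam f)"
      using fixed_points_translation[of f g] fg e by metis
    ultimately show False using translation_nonzero by simp
  qed
  show ?thesis
  \<comment> \<open>The condition on the exponent also keeps out translations, whose
    \<open>fixed_point\<close> is the default \<open>0\<close> and might equal
    \<open>p\<close>.\<close>
  proof (cases "\<exists>f\<in>P. of_rat (fixed_point lam f) = p \<and> exponent lam f > 0")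
    case True
    then have "P \<subseteq> type2_cone lam p \<sigma>1 1"
      using act opp sub unfolding type2_cone_def by (fastforce simp: linorder_neq_iff)
    then show ?thesis using that by blast
  next
    case False
    then have "P \<subseteq> type2_cone lam p \<sigma>1 (-1)"
      using act sub unfolding type2_cone_def by (fastforce simp: linorder_neq_iff)
    then show ?thesis using that by blast
  qed
qed

lemma subset_cone:
  obtains (type1) \<sigma>1 \<sigma>2 where "\<sigma>1 \<in> {1, -1}" "\<sigma>2 \<in> {1, -1}" "P \<subseteq> type1_cone lam \<sigma>1 \<sigma>2"
  | (type2) p \<sigma>1 \<sigma>2 where "\<sigma>1 \<in> {1, -1}" "\<sigma>2 \<in> {1, -1}" "P \<subseteq> type2_cone lam p \<sigma>1 \<sigma>2"
proof -
  define A :: "real set" where "A = {of_rat (fixed_point lam f) | f. f \<in> P \<and> exponent lam f > 0}"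
  define B :: "real set" where "B = {of_rat (fixed_point lam f) | f. f \<in> P \<and> exponent lam f < 0}"
  show ?thesis
  proof (cases "A = {} \<or> B = {}")
    case True
    \<comment> \<open>With no expanding or no contracting elements, the exponents have constant sign
      and type (1) applies.\<close>
    then have "(\<forall>f\<in>P. - 1 * exponent lam f \<ge> 0) \<or> (\<forall>f\<in>P. 1 * exponent lam f \<ge> 0)"
      unfolding A_def B_def by force
    then show ?thesis
      using subset_type1_cone[of "-1"] subset_type1_cone[of 1] type1 by (metis insertI1 insertI2)
  next
    case False
    then obtain f0 g0 where fg0: "f0 \<in> P" "exponent lam f0 > 0" "g0 \<in> P" "exponent lam g0 < 0"
      by (auto simp: A_def B_def)
    \<comment> \<open>An expanding and a contracting element yield a translation in
      \<open>P\<close>; its direction fixes \<open>\<sigma>\<close>.\<close>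
    obtain h where h: "h \<in> P" "exponent lam h = 0"
      using fixed_points_translation[OF fg0] by metis
    define \<sigma> :: int where "\<sigma> = (if h 0 > 0 then 1 else -1)"
    have s: "\<sigma> \<in> {1, -1}" by (simp add: \<sigma>_def)
    have tr: "of_int \<sigma> * f 0 > 0" if f: "f \<in> P" "exponent lam f = 0" for f
      using translations_same_sign[OF h f] translations_same_sign[OF f h]
        translation_nonzero[OF f] by (force simp: \<sigma>_def)
    have sep: "of_int \<sigma> * (b - a) > 0" if ab: "a \<in> A" "b \<in> B" for a b
    proof -
      obtain f g where fg: "f \<in> P" "exponent lam f > 0" "g \<in> P" "exponent lam g < 0"
        and ab_eq: "a = of_rat (fixed_point lam f)" "b = of_rat (fixed_point lam g)"
        using ab by (auto simp: A_def B_def)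
      obtain t c where "t \<in> P" "exponent lam t = 0" "c > 0"
        "t 0 = c * (fixed_point lam g - fixed_point lam f)"
        using fixed_points_translation[OF fg] by metis
      then have "of_int \<sigma> * (fixed_point lam g - fixed_point lam f) > 0"
        using tr[of t] by (auto simp: \<sigma>_def zero_less_mult_iff mult_less_0_iff split: if_splits)
      then show ?thesis using s by (auto simp: ab_eq of_rat_less)
    qed
    \<comment> \<open>For \<open>\<sigma> = -1\<close> the sets \<open>A\<close> and
      \<open>B\<close> exchange sides.\<close>
    obtain p where p: "\<And>a. a \<in> A \<Longrightarrow> of_int \<sigma> * (p - a) \<ge> 0" "\<And>b. b \<in> B \<Longrightarrow> of_int \<sigma> * (b - p) \<ge> 0"
    proof (cases "\<sigma> = 1")
      case True
      obtain p where "\<And>a. a \<in> A \<Longrightarrow> a \<le> p" "\<And>b. b \<in> B \<Longrightarrow> p \<le> b"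
        using exists_separating[of A B] sep False True by auto
      then show ?thesis using that[of p] True by simp
    next
      case neg: False
      then have m: "\<sigma> = -1" using s by simp
      obtain p where "\<And>b. b \<in> B \<Longrightarrow> b \<le> p" "\<And>a. a \<in> A \<Longrightarrow> p \<le> a"
      proof (rule exists_separating[of B A])
        show "b < a" if "b \<in> B" "a \<in> A" for a b using sep[OF that(2,1)] m by simp
      qed (use False in auto)
      then show ?thesis using that[of p] m by simp
    qed
    show ?thesis
    proof (rule subset_type2_cone[OF s, of p])
      show "of_int \<sigma> * f 0 > 0" if "f \<in> P" "exponent lam f = 0" for f
        using tr that .
      show "of_int \<sigma> * (p - of_rat (fixed_point lam f)) \<ge> 0" if "f \<in> P" "exponent lam f > 0" for f
        using p(1) that by (auto simp: A_def)
      show "of_int \<sigma> * (of_rat (fixed_point lam f) - p) \<ge> 0" if "f \<in> P" "exponent lam f < 0" for f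
        using p(2) that by (auto simp: B_def)
    qed (use type2[OF s] in auto)
  qed
qed

end

section \<open>Extension and classification of orders\<close>

text \<open>The last clause speaks of any left-order \<open>s\<close> with cone \<open>C\<close>, so
  that it applies both to a newly built extension and to \<open>r\<close> itself when
  \<open>r\<close> is total.\<close>

lemma partial_left_order_subset_cone:
  assumes r: "partial_left_order (affine_group lam) r"
  obtains C where "left_order_cone (affine_group lam) C" "positive_cone (affine_group lam) r \<subseteq> C"
    "\<And>s. left_order (affine_group lam) s \<Longrightarrow> positive_cone (affine_group lam) s = C \<Longrightarrow>
       is_type1 lam s \<or> is_type2 lam s"
proof -
  let ?P = "positive_cone (affine_group lam) r"
  have "?P \<subseteq> carrier (affine_group lam)"
    by (auto simp: positive_cone_def)
  moreover have "f \<circ> g \<in> ?P" if "f \<in> ?P" "g \<in> ?P" for f g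
    using positive_cone_mult[OF r that] by (simp add: affine_group_def)
  moreover have "id \<notin> ?P"
    by (simp add: positive_cone_def affine_group_def)
  ultimately show thesis
  proof (rule subset_cone)
    fix \<sigma>1 \<sigma>2 assume s: "\<sigma>1 \<in> {1, -1}" "\<sigma>2 \<in> {1, -1 :: int}" and "?P \<subseteq> type1_cone lam \<sigma>1 \<sigma>2"
    then show ?thesis
      using that[OF left_order_cone_type1[OF s]] unfolding is_type1_def type1_cone_def by blast
  next
    fix p \<sigma>1 \<sigma>2 assume s: "\<sigma>1 \<in> {1, -1}" "\<sigma>2 \<in> {1, -1 :: int}" and "?P \<subseteq> type2_cone lam p \<sigma>1 \<sigma>2"
    then show ?thesis
      using that[OF left_order_cone_type2[OF s]] unfolding is_type2_def type2_cone_def by blast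
  qed
qed

end

theorem corollary30:
  fixes lam :: rat
  assumes "lam > 1"
  shows "fully_left_orderable (affine_group lam) \<and>
    (\<forall>r. partial_left_order (affine_group lam) r \<longrightarrow>
       (\<exists>s. left_order (affine_group lam) s \<and> order_extends (affine_group lam) s r \<and>
            (is_type1 lam s \<or> is_type2 lam s))) \<and>
    (\<forall>r. left_order (affine_group lam) r \<longrightarrow> is_type1 lam r \<or> is_type2 lam r)"
proof -
  interpret group "affine_group lam" by (rule group_affine_group[OF assms])
  \<comment> \<open>The extension is \<open>cone_order\<close> of the cone obtained.\<close>
  have extend: "\<exists>s. left_order (affine_group lam) s \<and> order_extends (affine_group lam) s r \<and>
      (is_type1 lam s \<or> is_type2 lam s)" if "partial_left_order (affine_group lam) r" for r
    using partial_left_order_subset_cone[OF assms that] left_order_cone_order positive_cone_order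
    unfolding order_extends_def by metis
  \<comment> \<open>By maximality, the cone of a left-order \<open>r\<close> equals the cone of type
    (1) or (2) that contains it.\<close>
  moreover have "is_type1 lam r \<or> is_type2 lam r" if "left_order (affine_group lam) r" for r
    using partial_left_order_subset_cone[OF assms, of r] positive_cone_eq[OF that] that
    unfolding left_order_def by metis
  ultimately show ?thesis unfolding fully_left_orderable_def by blast
qed

end
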